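(* Let $X_1,\dots,X_n$ be i.i.d. real random variables with well-defined mean $\mu$, finite variance $\sigma^2$, and such that there exist $p>2$ and $\kappa_{2,p}\geq 1$ with $\mathbb{E}|X_1-\mu|^p\leq (\kappa_{2,p}\sigma)^p$. Assume $k_*\in\mathbb{N}$ satisfies \[432\,\frac{k_*^{3/2}}{n}+24\sqrt{2}\,\kappa_{2,p}\,\frac{k_*^{\frac{3p-4}{4p-4}}}{n^{\frac{p-2}{4p-4}}}\leq 1.\] Then for any $0<x\leq\sqrt{2k_*}$, \[\Pr\left(|\overline{X}_{n,k_*}-\mu|>\frac{(1+x)\,\sigma}{\sqrt{n}}\right)\leq 4\exp\left(-\frac{x^2}{2}\right).\]
   Context: For $X_{(1)}\leq\dots\leq X_{(n)}$ the order statistics of the sample and an integer $0\le k<n/2$, the $k$-trimmed mean is $\overline{X}_{n,k}:=\frac{1}{n-2k}\sum_{i=k+1}^{n-k}X_{(i)}$. *)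

theory Defs
  imports "HOL-Probability.Probability"
begin

definition trimmed_mean :: "nat \<Rightarrow> nat \<Rightarrow> (nat \<Rightarrow> real) \<Rightarrow> real" where
  "trimmed_mean n k xs =
     sum_list (take (n - 2 * k) (drop k (sort (map xs [0..<n])))) / real (n - 2 * k)"

end

(* Clamp the centred sample at level B = kappa sigma (e^2 n/k)^(1/p), so that by Markov's
   inequality each point lies outside [-B, B] with probability at most k/(e^2 n). By a Chernoff
   bound, more than k points lie outside with probability at most e^(-k) <= e^(-x^2/2).
   Otherwise every point outside is trimmed, so the trimmed sum differs from the sum of the
   clamped variables by at most 2kB. The clamped variables have bias at most kB/(e^2 n) and
   variance proxy close to sigma^2, so a Chernoff bound with parameter x/(sigma sqrt n) gives each
   tail of their sum. With D = kB/(sigma sqrt n), the assumption on k gives D <= 1/10, so all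
   errors, together with the factor n/(n - 2k), are absorbed by the summand 1 in 1 + x. *)

theory Submission
  imports Defs
begin

section \<open>Deterministic comparison of the trimmed sum with the clamped sum\<close>

text \<open>The hypothesis \<open>count\<close> says that at most k sample points lie farther than B
  from \<mu>. Then no kept point is outside, so clamping leaves the kept points alone, and the two
  sums differ only by the clamped values at the 2k trimmed positions, each at most B in absolute
  value.\<close>

lemma trimmed_sum_near_clamped_sum:
  fixes xs :: "nat \<Rightarrow> real"
  assumes k: "2 * k < n" and B: "B \<ge> 0"
    and count: "(\<Sum>i<n. if \<bar>xs i - \<mu>\<bar> > B then 1 else 0) < real k + 1"
  shows "\<bar>real (n - 2 * k) * (trimmed_mean n k xs - \<mu>)
           - (\<Sum>i<n. max (- B) (min B (xs i - \<mu>)))\<bar> \<le> 2 * real k * B"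
proof -
  define ys where "ys = sort (map xs [0..<n])"
  define f where "f = (\<lambda>y. max (- B) (min B (y - \<mu>)))"
  have len: "length ys = n" by (simp add: ys_def)
  have sorted: "sorted ys" by (simp add: ys_def)
  \<comment> \<open>Sorting preserves the multiset of values, so symmetric sums may be computed on
    either list.\<close>
  have sum_sort: "(\<Sum>j<n. g (ys ! j)) = (\<Sum>i<n. g (xs i))" for g :: "real \<Rightarrow> real"
  proof -
    have "(\<Sum>j<n. g (ys ! j)) = sum_list (map g ys)"
      by (simp add: sum_list_sum_nth len atLeast0LessThan)
    also have "\<dots> = sum_mset (image_mset g (mset ys))"
      by (metis mset_map sum_mset_sum_list)
    also have "\<dots> = sum_mset (image_mset g (mset (map xs [0..<n])))"
      by (simp add: ys_def)
    also have "\<dots> = sum_list (map g (map xs [0..<n]))"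
      by (metis mset_map sum_mset_sum_list)
    also have "\<dots> = (\<Sum>i<n. g (xs i))"
      by (simp add: sum_list_sum_nth atLeast0LessThan)
    finally show ?thesis .
  qed
  have count': "(\<Sum>j<n. if \<bar>ys ! j - \<mu>\<bar> > B then 1 else 0) < real k + 1"
    using count by (subst sum_sort[of "\<lambda>y. if \<bar>y - \<mu>\<bar> > B then 1 else 0"])
  have few: "card J \<le> k" if J: "J \<subseteq> {..<n}" "\<And>j. j \<in> J \<Longrightarrow> \<bar>ys ! j - \<mu>\<bar> > B" for J
  proof -
    have "real (card J) = (\<Sum>j\<in>J. if \<bar>ys ! j - \<mu>\<bar> > B then 1 else 0)"
      using J(2) by simp
    also have "\<dots> \<le> (\<Sum>j<n. if \<bar>ys ! j - \<mu>\<bar> > B then 1 else 0)"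
      using J(1) by (intro sum_mono2) auto
    finally show ?thesis using count' by linarith
  qed
  have mid: "\<bar>ys ! j - \<mu>\<bar> \<le> B" if j: "j \<in> {k..<n-k}" for j
  proof (rule ccontr)
    assume out: "\<not> \<bar>ys ! j - \<mu>\<bar> \<le> B"
    show False
    \<comment> \<open>By sortedness, an outside entry at a kept position j makes a whole end of the
      list outside: positions j to n-1 if it lies above \<mu>, positions 0 to j otherwise. As k
      \<le> j < n-k, either end has more than k entries, contradicting \<open>few\<close>.\<close>
    proof (cases "ys ! j > \<mu>")
      case True
      have "\<bar>ys ! i - \<mu>\<bar> > B" if "i \<in> {j..<n}" for i
        using sorted_nth_mono[OF sorted, of j i] that len True out by auto
      then have "card {j..<n} \<le> k" by (intro few) auto
      then show False using j by auto
    next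
      case False
      have "\<bar>ys ! i - \<mu>\<bar> > B" if "i \<in> {..j}" for i
      proof -
        have "ys ! i \<le> ys ! j"
          using that len j by (intro sorted_nth_mono[OF sorted]) auto
        then show ?thesis using False out by linarith
      qed
      then have "card {..j} \<le> k" using j by (intro few) auto
      then show False using j by auto
    qed
  qed
  have "sum_list (take (n - 2 * k) (drop k ys)) = (\<Sum>j<n - 2 * k. ys ! (j + k))"
    using k by (simp add: sum_list_sum_nth len atLeast0LessThan add.commute)
  also have "\<dots> = (\<Sum>j\<in>{k..<n - k}. ys ! j)"
    by (rule sum.reindex_bij_witness[of _ "\<lambda>j. j - k" "\<lambda>j. j + k"]) (use k in auto)
  finally have "real (n - 2 * k) * trimmed_mean n k xs = (\<Sum>j\<in>{k..<n - k}. ys ! j)"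
    using k by (simp add: trimmed_mean_def ys_def)
  then have "real (n - 2 * k) * (trimmed_mean n k xs - \<mu>) = (\<Sum>j\<in>{k..<n - k}. ys ! j - \<mu>)"
    by (simp add: sum_subtractf right_diff_distrib mult_2)
  also have "\<dots> = (\<Sum>j\<in>{k..<n - k}. f (ys ! j))"
    by (intro sum.cong refl) (use mid in \<open>force simp: f_def\<close>)
  finally have 1: "real (n - 2 * k) * (trimmed_mean n k xs - \<mu>) = (\<Sum>j\<in>{k..<n - k}. f (ys ! j))" .
  have "(\<Sum>i<n. f (xs i)) = (\<Sum>j\<in>{k..<n - k}. f (ys ! j)) + (\<Sum>j\<in>{..<n} - {k..<n - k}. f (ys ! j))"
    by (subst sum_sort[symmetric], subst sum.subset_diff[of "{k..<n - k}"]) auto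
  moreover have "\<bar>\<Sum>j\<in>{..<n} - {k..<n - k}. f (ys ! j)\<bar> \<le> 2 * real k * B"
  proof -
    have "\<bar>\<Sum>j\<in>{..<n} - {k..<n - k}. f (ys ! j)\<bar> \<le> (\<Sum>j\<in>{..<n} - {k..<n - k}. B)"
      using B by (intro sum_abs[THEN order_trans] sum_mono) (auto simp: f_def)
    also have "card ({..<n} - {k..<n - k}) = 2 * k"
      using k by (subst card_Diff_subset) auto
    then have "(\<Sum>j\<in>{..<n} - {k..<n - k}. B) = 2 * real k * B" by simp
    finally show ?thesis .
  qed
  ultimately show ?thesis using 1 by (simp add: f_def)
qed

section \<open>A quadratic bound for the exponential and a Chernoff bound for i.i.d. sums\<close>

text \<open>Second-order Taylor expansion with Lagrange remainder: the intermediate point t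
  satisfies |t| \<le> |y| \<le> b.\<close>

lemma exp_le_quadratic:
  fixes y b :: real
  assumes "\<bar>y\<bar> \<le> b"
  shows "exp y \<le> 1 + y + y\<^sup>2 / 2 * exp b"
proof -
  obtain t where t: "\<bar>t\<bar> \<le> \<bar>y\<bar>" "exp y = (\<Sum>m<2. y ^ m / fact m) + exp t / fact 2 * y ^ 2"
    using Maclaurin_exp_le by blast
  have "exp t * y\<^sup>2 \<le> exp b * y\<^sup>2"
    using t(1) assms by (intro mult_right_mono) auto
  then show ?thesis using t(2) by (simp add: numeral_2_eq_2 field_simps)
qed

context prob_space
begin

lemma integrable_bounded_comp:
  fixes g :: "real \<Rightarrow> real"
  assumes "Y \<in> borel_measurable M" "g \<in> borel_measurable borel" "\<And>y. \<bar>g y\<bar> \<le> b"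
  shows "integrable M (\<lambda>\<omega>. g (Y \<omega>))"
  by (rule integrable_const_bound[of _ b]) (use assms in auto)

text \<open>Markov's inequality for the exponential of the sum, whose expectation factors by
  independence. The Chernoff parameter is absorbed into g, and the upper bound b on g serves to make
  the exponentials integrable.\<close>

lemma iid_sum_Chernoff:
  fixes X :: "nat \<Rightarrow> 'a \<Rightarrow> real" and g :: "real \<Rightarrow> real"
  assumes indep: "indep_vars (\<lambda>_. borel) X {..<n}"
    and ident: "\<And>i. i < n \<Longrightarrow> distr M borel (X i) = distr M borel (X 0)"
    and g[measurable]: "g \<in> borel_measurable borel" and bdd: "\<And>y. g y \<le> b"
    and mgf: "expectation (\<lambda>\<omega>. exp (g (X 0 \<omega>))) \<le> exp c"
    and n: "n \<ge> 1"
  shows "prob {\<omega> \<in> space M. (\<Sum>i<n. g (X i \<omega>)) \<ge> s} \<le> exp (real n * c - s)"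
proof -
  have meas[measurable]: "X i \<in> borel_measurable M" if "i < n" for i
    using indep that by (auto simp: indep_vars_def)
  have int: "integrable M (\<lambda>\<omega>. exp (g (X i \<omega>)))" if "i < n" for i
    by (rule integrable_bounded_comp[of "X i" "\<lambda>y. exp (g y)" "exp b"]) (use that bdd in auto)
  have eq: "expectation (\<lambda>\<omega>. exp (g (X i \<omega>))) = expectation (\<lambda>\<omega>. exp (g (X 0 \<omega>)))" if "i < n" for i
  proof -
    have "expectation (\<lambda>\<omega>. exp (g (X i \<omega>))) = (\<integral>y. exp (g y) \<partial>distr M borel (X i))"
      using that by (subst integral_distr) auto
    also have "\<dots> = (\<integral>y. exp (g y) \<partial>distr M borel (X 0))"
      by (simp only: ident[OF that])
    also have "\<dots> = expectation (\<lambda>\<omega>. exp (g (X 0 \<omega>)))"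
      using n by (subst integral_distr) auto
    finally show ?thesis .
  qed
  have ind: "indep_vars (\<lambda>_. borel) (\<lambda>i \<omega>. exp (g (X i \<omega>))) {..<n}"
    by (rule indep_vars_compose2[OF indep]) auto
  have prod: "expectation (\<lambda>\<omega>. \<Prod>i<n. exp (g (X i \<omega>))) = (\<Prod>i<n. expectation (\<lambda>\<omega>. exp (g (X i \<omega>))))"
    using int by (intro indep_vars_lebesgue_integral ind) auto
  have intp: "integrable M (\<lambda>\<omega>. exp (\<Sum>i<n. g (X i \<omega>)))"
    using indep_vars_integrable[OF _ ind] int by (simp add: exp_sum)
  have "exp s * prob {\<omega> \<in> space M. (\<Sum>i<n. g (X i \<omega>)) \<ge> s}
      \<le> expectation (\<lambda>\<omega>. exp (\<Sum>i<n. g (X i \<omega>)))"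
    using integral_Markov_inequality_measure[OF intp, of "{}" "exp s"]
    by (simp add: field_simps)
  also have "\<dots> = (\<Prod>i<n. expectation (\<lambda>\<omega>. exp (g (X i \<omega>))))"
    using prod by (simp add: exp_sum)
  also have "\<dots> = (\<Prod>i<n. expectation (\<lambda>\<omega>. exp (g (X 0 \<omega>))))"
    by (intro prod.cong refl eq) auto
  also have "\<dots> = expectation (\<lambda>\<omega>. exp (g (X 0 \<omega>))) ^ n"
    by simp
  also have "\<dots> \<le> exp c ^ n"
    using mgf by (intro power_mono) auto
  also have "\<dots> = exp (real n * c)"
    by (simp add: exp_of_nat_mult)
  finally show ?thesis
    by (simp add: exp_diff field_simps)
qed

section \<open>Tail, bias and exponential moment of the clamped variable\<close>

text \<open>Where |z| > B, the ratio |z|/B exceeds 1, so p \<ge> 1 gives both 1 \<le> (|z|/B)^p and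
  |z| \<le> B (|z|/B)^p. Taking expectations, the first yields the tail bound. The second yields the
  bias bound: Y - \<mu> has mean zero, so the bias is the mean change caused by clamping, which
  vanishes inside [-B, B] and is at most |z| outside.\<close>

lemma
  fixes Y :: "'a \<Rightarrow> real"
  assumes int: "integrable M (\<lambda>\<omega>. \<bar>Y \<omega> - \<mu>\<bar> powr p)"
    and Y[measurable]: "Y \<in> borel_measurable M"
    and B: "B > 0" and p: "p \<ge> 1"
    and mom: "expectation (\<lambda>\<omega>. \<bar>Y \<omega> - \<mu>\<bar> powr p) \<le> h * B powr p"
  shows tail_indicator_le: "expectation (\<lambda>\<omega>. if \<bar>Y \<omega> - \<mu>\<bar> > B then 1 else 0) \<le> h"
    and clamp_bias_le: "integrable M Y \<Longrightarrow> expectation Y = \<mu> \<Longrightarrow>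
      \<bar>expectation (\<lambda>\<omega>. max (- B) (min B (Y \<omega> - \<mu>)))\<bar> \<le> h * B"
proof -
  have pw: "1 \<le> \<bar>z\<bar> powr p / B powr p" "\<bar>z\<bar> \<le> B * (\<bar>z\<bar> powr p / B powr p)" if "\<bar>z\<bar> > B" for z
  proof -
    have z: "1 \<le> \<bar>z\<bar> / B" using that B by simp
    have "\<bar>z\<bar> / B \<le> (\<bar>z\<bar> / B) powr p"
      using powr_mono[OF p z] B by simp
    with z have "\<bar>z\<bar> / B \<le> (\<bar>z\<bar> / B) powr p" "1 \<le> (\<bar>z\<bar> / B) powr p"
      by linarith+
    then show "1 \<le> \<bar>z\<bar> powr p / B powr p" "\<bar>z\<bar> \<le> B * (\<bar>z\<bar> powr p / B powr p)"
      using B by (simp_all add: powr_divide field_simps)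
  qed
  have E: "expectation (\<lambda>\<omega>. \<bar>Y \<omega> - \<mu>\<bar> powr p / B powr p) \<le> h"
    using mom B by (simp add: field_simps)
  have intB: "integrable M (\<lambda>\<omega>. \<bar>Y \<omega> - \<mu>\<bar> powr p / B powr p)"
    using int by simp
  have "expectation (\<lambda>\<omega>. if \<bar>Y \<omega> - \<mu>\<bar> > B then 1 else 0)
      \<le> expectation (\<lambda>\<omega>. \<bar>Y \<omega> - \<mu>\<bar> powr p / B powr p)"
    by (intro integral_mono intB integrable_bounded_comp[of Y _ 1]) (use pw in auto)
  with E show "expectation (\<lambda>\<omega>. if \<bar>Y \<omega> - \<mu>\<bar> > B then 1 else 0) \<le> h" by linarith
  assume intY: "integrable M Y" and mean: "expectation Y = \<mu>"
  define C where "C = (\<lambda>\<omega>. max (- B) (min B (Y \<omega> - \<mu>)))"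
  have intC: "integrable M C" unfolding C_def
    by (rule integrable_bounded_comp[of Y _ B]) (use B in auto)
  have le: "\<bar>C \<omega> - (Y \<omega> - \<mu>)\<bar> \<le> B * (\<bar>Y \<omega> - \<mu>\<bar> powr p / B powr p)" for \<omega>
  proof (cases "\<bar>Y \<omega> - \<mu>\<bar> > B")
    case True
    then have "\<bar>C \<omega> - (Y \<omega> - \<mu>)\<bar> \<le> \<bar>Y \<omega> - \<mu>\<bar>"
      using B by (auto simp: C_def)
    with pw(2)[OF True] show ?thesis by linarith
  next
    case False
    then have "C \<omega> = Y \<omega> - \<mu>" by (auto simp: C_def)
    then show ?thesis using B by simp
  qed
  have "expectation C = expectation (\<lambda>\<omega>. C \<omega> - (Y \<omega> - \<mu>))"
    using intC intY mean by (simp add: prob_space)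
  also have "\<bar>\<dots>\<bar> \<le> expectation (\<lambda>\<omega>. \<bar>C \<omega> - (Y \<omega> - \<mu>)\<bar>)"
    by (rule integral_abs_bound)
  also have "\<dots> \<le> expectation (\<lambda>\<omega>. B * (\<bar>Y \<omega> - \<mu>\<bar> powr p / B powr p))"
    using intC intY le by (intro integral_mono integrable_mult_right intB) auto
  also have "\<dots> = B * expectation (\<lambda>\<omega>. \<bar>Y \<omega> - \<mu>\<bar> powr p / B powr p)"
    by (rule integral_mult_right_zero)
  also have "\<dots> \<le> B * h" using E B by (intro mult_left_mono) auto
  finally show "\<bar>expectation (\<lambda>\<omega>. max (- B) (min B (Y \<omega> - \<mu>)))\<bar> \<le> h * B"
    by (simp add: C_def mult.commute)
qed

text \<open>Clamping makes \<open>exp_le_quadratic\<close> applicable with the uniform bound |c| B,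
  while the square of the clamped variable is still dominated by that of Y - \<mu>. The linear term
  then costs only the bias d and the quadratic term only v; finally 1 + u \<le> exp u.\<close>

lemma clamp_mgf_le:
  fixes Y :: "'a \<Rightarrow> real"
  assumes intY: "integrable M Y" and int2: "integrable M (\<lambda>\<omega>. (Y \<omega> - \<mu>)\<^sup>2)"
    and var: "expectation (\<lambda>\<omega>. (Y \<omega> - \<mu>)\<^sup>2) \<le> v"
    and B: "B > 0"
    and bias: "\<bar>expectation (\<lambda>\<omega>. max (- B) (min B (Y \<omega> - \<mu>)))\<bar> \<le> d"
  shows "expectation (\<lambda>\<omega>. exp (c * max (- B) (min B (Y \<omega> - \<mu>))))
           \<le> exp (\<bar>c\<bar> * d + c\<^sup>2 * v / 2 * exp (\<bar>c\<bar> * B))"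
proof -
  have Y[measurable]: "Y \<in> borel_measurable M" using intY by auto
  define C where "C = (\<lambda>\<omega>. max (- B) (min B (Y \<omega> - \<mu>)))"
  have bdd: "\<bar>C \<omega>\<bar> \<le> B" for \<omega> using B by (auto simp: C_def)
  have [measurable]: "C \<in> borel_measurable M" unfolding C_def by simp
  have intC: "integrable M C"
    by (rule integrable_const_bound[of _ B]) (use bdd in auto)
  have cb: "\<bar>c * C \<omega>\<bar> \<le> \<bar>c\<bar> * B" for \<omega>
    using bdd by (simp add: abs_mult mult_left_mono)
  have intE: "integrable M (\<lambda>\<omega>. exp (c * C \<omega>))"
    by (rule integrable_const_bound[of _ "exp (\<bar>c\<bar> * B)"]) (use cb abs_le_D1 in \<open>auto simp: abs_le_iff\<close>)
  define K where "K = c\<^sup>2 / 2 * exp (\<bar>c\<bar> * B)"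
  have K: "K \<ge> 0" by (simp add: K_def)
  have pt: "exp (c * C \<omega>) \<le> 1 + c * C \<omega> + K * (Y \<omega> - \<mu>)\<^sup>2" for \<omega>
  proof -
    have "(C \<omega>)\<^sup>2 \<le> (Y \<omega> - \<mu>)\<^sup>2"
      using B by (intro abs_le_square_iff[THEN iffD1]) (auto simp: C_def)
    then have "K * (C \<omega>)\<^sup>2 \<le> K * (Y \<omega> - \<mu>)\<^sup>2" using K by (rule mult_left_mono)
    then show ?thesis using exp_le_quadratic[OF cb, of \<omega>]
      by (simp add: K_def power_mult_distrib algebra_simps)
  qed
  have "expectation (\<lambda>\<omega>. exp (c * C \<omega>)) \<le> expectation (\<lambda>\<omega>. 1 + c * C \<omega> + K * (Y \<omega> - \<mu>)\<^sup>2)"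
    using intE intC int2 pt by (intro integral_mono) auto
  also have "\<dots> = 1 + c * expectation C + K * expectation (\<lambda>\<omega>. (Y \<omega> - \<mu>)\<^sup>2)"
    using intC int2 by (simp add: prob_space)
  also have "\<dots> \<le> 1 + \<bar>c\<bar> * d + K * v"
  proof -
    have "c * expectation C \<le> \<bar>c\<bar> * \<bar>expectation C\<bar>"
      by (metis abs_ge_self abs_mult)
    also have "\<dots> \<le> \<bar>c\<bar> * d" using bias by (intro mult_left_mono) (auto simp: C_def)
    finally show ?thesis using mult_left_mono[OF var K] by linarith
  qed
  also have "\<dots> \<le> exp (\<bar>c\<bar> * d + K * v)"
    using exp_ge_add_one_self[of "\<bar>c\<bar> * d + K * v"] by linarith
  finally show ?thesis by (simp add: C_def K_def mult_ac)
qed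

section \<open>The deviation bound in normalised parameters\<close>

text \<open>The probabilistic core, kept free of the explicit choice of B: h bounds the probability
  of lying outside, D is kB in units of \<sigma> sqrt n, and \<open>xk\<close> is the numerical
  condition that absorbs all errors. Three exceptional events, each of probability at most
  exp(-x^2/2), cover the deviation: too many outside points, and the clamped sum being too large or
  too small.\<close>

lemma trimmed_mean_deviation:
  fixes X :: "nat \<Rightarrow> 'a \<Rightarrow> real"
  assumes indep: "indep_vars (\<lambda>_. borel) X {..<n}"
    and ident: "\<And>i. i < n \<Longrightarrow> distr M borel (X i) = distr M borel (X 0)"
    and k: "1 \<le> k" "2 * k < n"
    and intX: "integrable M (X 0)" and mean: "expectation (X 0) = \<mu>"
    and intv: "integrable M (\<lambda>\<omega>. (X 0 \<omega> - \<mu>)\<^sup>2)"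
    and var: "expectation (\<lambda>\<omega>. (X 0 \<omega> - \<mu>)\<^sup>2) \<le> \<sigma>\<^sup>2" and \<sigma>: "\<sigma> > 0"
    and intp: "integrable M (\<lambda>\<omega>. \<bar>X 0 \<omega> - \<mu>\<bar> powr p)" and p: "p \<ge> 1"
    and mom: "expectation (\<lambda>\<omega>. \<bar>X 0 \<omega> - \<mu>\<bar> powr p) \<le> h * B powr p" and B: "B > 0"
    and h: "real n * h * exp 2 = real k"
    and BD: "real k * B = D * (\<sigma> * sqrt (real n))" and D: "D \<le> 1 / 10"
    and x: "0 < x" "x \<le> sqrt (2 * real k)"
    and xk: "(x + 5 * D) * real n \<le> (1 + x) * (real n - 2 * real k)"
  shows "prob {\<omega> \<in> space M. \<bar>trimmed_mean n k (\<lambda>i. X i \<omega>) - \<mu>\<bar> > (1 + x) * \<sigma> / sqrt (real n)}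
           \<le> 3 * exp (- (x\<^sup>2) / 2)"
proof -
  have n: "n \<ge> 1" "real n > 0" using k by auto
  have meas: "X i \<in> borel_measurable M" if "i < n" for i
    using indep that by (auto simp: indep_vars_def)
  have X0: "X 0 \<in> borel_measurable M" using intX by auto
  define s where "s = \<sigma> * sqrt (real n)"
  define l where "l = x / s"
  have s: "s > 0" "s\<^sup>2 = \<sigma>\<^sup>2 * real n" using \<sigma> n by (simp_all add: s_def power_mult_distrib)
  have l: "l > 0" "l * s = x" using s x by (simp_all add: l_def)
  have D0: "D > 0"
  proof -
    have "D * s > 0" using B k unfolding s_def BD[symmetric] by simp
    then show ?thesis using s(1) by (simp add: zero_less_mult_iff)
  qed
  have xsq: "x\<^sup>2 \<le> 2 * real k"
    using power_mono[OF x(2), of 2] x(1) by simp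
  have h0: "h > 0"
  proof -
    have "real n * h * exp 2 > 0" using k unfolding h by simp
    then show ?thesis using n by (simp add: zero_less_mult_iff)
  qed
  define N where "N = (\<lambda>z. if \<bar>z - \<mu>\<bar> > B then 1 else (0::real))"
  define C where "C = (\<lambda>z. max (- B) (min B (z - \<mu>)))"
  have Nm[measurable]: "N \<in> borel_measurable borel" and Cm[measurable]: "C \<in> borel_measurable borel"
    unfolding N_def C_def by measurable
  have Cb: "\<bar>C z\<bar> \<le> B" for z using B by (auto simp: C_def)
  \<comment> \<open>The Chernoff parameter 2 matches the factor e^2 in \<open>h\<close>: as N takes
    only the values 0 and 1, exp(2N) is affine in N. The resulting exponent is n h e^2 - 2k = -k, at
    most -x^2/2 because x^2 \<le> 2k.\<close>
  have "expectation (\<lambda>\<omega>. exp (2 * N (X 0 \<omega>))) \<le> exp (h * exp 2)"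
  proof -
    have "exp (2 * N z) = 1 + (exp 2 - 1) * N z" for z by (simp add: N_def)
    moreover have "integrable M (\<lambda>\<omega>. N (X 0 \<omega>))"
      by (rule integrable_bounded_comp[of _ _ 1]) (auto simp: X0 N_def)
    ultimately have "expectation (\<lambda>\<omega>. exp (2 * N (X 0 \<omega>))) = 1 + (exp 2 - 1) * expectation (\<lambda>\<omega>. N (X 0 \<omega>))"
      by (simp add: prob_space)
    also have "\<dots> \<le> 1 + (exp 2 - 1) * h"
      using tail_indicator_le[OF intp X0 B p mom] by (simp add: N_def mult_left_mono)
    also have "\<dots> \<le> 1 + h * exp 2" using h0 by (simp add: algebra_simps)
    also have "\<dots> \<le> exp (h * exp 2)" by (rule exp_ge_add_one_self)
    finally show ?thesis .
  qed
  then have "prob {\<omega> \<in> space M. (\<Sum>i<n. 2 * N (X i \<omega>)) \<ge> 2 * real k} \<le> exp (real n * (h * exp 2) - 2 * real k)"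
    using n by (intro iid_sum_Chernoff[OF indep ident, where b = 2]) (auto simp: N_def)
  also have "\<dots> \<le> exp (- (x\<^sup>2) / 2)"
    using h xsq by (simp add: mult_ac)
  finally have P1: "prob {\<omega> \<in> space M. (\<Sum>i<n. 2 * N (X i \<omega>)) \<ge> 2 * real k} \<le> exp (- (x\<^sup>2) / 2)" .

  \<comment> \<open>Total contribution of the bias to the exponent; it equals xD/e^2, and the factor
    e^2 is given away.\<close>
  have hB: "real n * (l * (h * B)) \<le> x * D"
  proof -
    have "real n * (l * (h * B)) * exp 2 = l * (real n * h * exp 2 * B)" by simp
    also have "\<dots> = x * D" using BD l(2) by (simp add: h s_def[symmetric])
    finally have "real n * (l * (h * B)) * exp 2 = x * D" .
    moreover have "real n * (l * (h * B)) * 1 \<le> real n * (l * (h * B)) * exp 2"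
      using n l h0 B by (intro mult_left_mono) auto
    ultimately show ?thesis by simp
  qed
  \<comment> \<open>From lBk = xD, x \<le> 2k and D \<le> 1/10 follows lB \<le> 1/2, where exp u
    \<le> 1 + 2u holds. The excess x^2 lB is then at most 2k lB = 2xD.\<close>
  have el: "x\<^sup>2 / 2 * exp (l * B) \<le> x\<^sup>2 / 2 + 2 * x * D"
  proof -
    have lB: "l * B * real k = x * D"
      using BD l(2) by (metis s_def mult.assoc mult.commute)
    have "2 * real k * 1 \<le> 2 * real k * (2 * real k)" using k by (intro mult_left_mono) auto
    then have "x\<^sup>2 \<le> (2 * real k)\<^sup>2" using xsq by (simp add: power2_eq_square)
    then have "x \<le> 2 * real k" by (rule power2_le_imp_le) simp
    then have "x * D \<le> 2 * real k * (1 / 10)" using D D0 by (intro mult_mono) auto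
    then have "l * B * real k \<le> 1 / 2 * real k" using lB by simp
    then have "l * B \<le> 1 / 2" using k by simp
    moreover have "l * B \<ge> 0" using l B by simp
    ultimately have "exp (l * B) \<le> 1 + 2 * (l * B)"
      using exp_bound_lemma[of "l * B"] by simp
    then have "x\<^sup>2 / 2 * exp (l * B) \<le> x\<^sup>2 / 2 * (1 + 2 * (l * B))" by (intro mult_left_mono) auto
    also have "\<dots> = x\<^sup>2 / 2 + x\<^sup>2 * (l * B)" by (simp add: algebra_simps)
    also have "x\<^sup>2 * (l * B) \<le> 2 * real k * (l * B)" using xsq l B by (intro mult_right_mono) auto
    finally show ?thesis using lB by (simp add: mult_ac)
  qed
  \<comment> \<open>The two signs of c give the two tails. The threshold equals x^2 + 3xD, where 3xD
    pays for the bias (xD, by \<open>hB\<close>) and for the variance inflation (2xD, by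
    \<open>el\<close>), leaving x^2/2 - x^2 in the exponent.\<close>
  have P2: "prob {\<omega> \<in> space M. (\<Sum>i<n. c * C (X i \<omega>)) \<ge> l * (s * (x + 3 * D))} \<le> exp (- (x\<^sup>2) / 2)"
    if c: "\<bar>c\<bar> = l" for c
  proof -
    have "prob {\<omega> \<in> space M. (\<Sum>i<n. c * C (X i \<omega>)) \<ge> l * (s * (x + 3 * D))}
        \<le> exp (real n * (\<bar>c\<bar> * (h * B) + c\<^sup>2 * \<sigma>\<^sup>2 / 2 * exp (\<bar>c\<bar> * B)) - l * (s * (x + 3 * D)))"
    proof (rule iid_sum_Chernoff[OF indep ident, where b = "l * B"])
      show "c * C y \<le> l * B" for y
        using Cb[of y] c l B by (metis abs_ge_self abs_ge_zero abs_mult mult_left_mono order_trans)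
      show "expectation (\<lambda>\<omega>. exp (c * C (X 0 \<omega>))) \<le> exp (\<bar>c\<bar> * (h * B) + c\<^sup>2 * \<sigma>\<^sup>2 / 2 * exp (\<bar>c\<bar> * B))"
        unfolding C_def
        by (rule clamp_mgf_le[OF intX intv var B clamp_bias_le[OF intp X0 B p mom intX mean]])
    qed (use n in auto)
    also have "real n * (\<bar>c\<bar> * (h * B) + c\<^sup>2 * \<sigma>\<^sup>2 / 2 * exp (\<bar>c\<bar> * B)) - l * (s * (x + 3 * D)) \<le> - (x\<^sup>2) / 2"
    proof -
      have "c\<^sup>2 * \<sigma>\<^sup>2 * real n = (l * s)\<^sup>2"
        using c s(2) by (metis power2_abs power_mult_distrib mult.assoc)
      then have q1: "real n * (c\<^sup>2 * \<sigma>\<^sup>2 / 2 * exp (l * B)) = x\<^sup>2 / 2 * exp (l * B)"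
        using l(2) by (simp add: mult_ac)
      have q2: "l * (s * (x + 3 * D)) = x\<^sup>2 + 3 * (x * D)"
        using l(2) by (simp add: mult.assoc[symmetric] power2_eq_square distrib_left)
      show ?thesis
        unfolding c distrib_left[of "real n"] q1 q2 using hB el by simp
    qed
    finally show ?thesis by simp
  qed

  define E1 where "E1 = {\<omega> \<in> space M. (\<Sum>i<n. 2 * N (X i \<omega>)) \<ge> 2 * real k}"
  define E2 where "E2 c = {\<omega> \<in> space M. (\<Sum>i<n. c * C (X i \<omega>)) \<ge> l * (s * (x + 3 * D))}" for c
  have sum_meas: "(\<lambda>\<omega>. \<Sum>i<n. c * g (X i \<omega>)) \<in> borel_measurable M"
    if "g \<in> borel_measurable borel" for g :: "real \<Rightarrow> real" and c
    using measurable_compose[OF meas that]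
    by (intro borel_measurable_sum borel_measurable_times borel_measurable_const) auto
  have ev: "E1 \<in> events" "E2 c \<in> events" for c
    unfolding E1_def E2_def by (intro borel_measurable_le borel_measurable_const sum_meas Nm Cm)+
  have sub: "{\<omega> \<in> space M. \<bar>trimmed_mean n k (\<lambda>i. X i \<omega>) - \<mu>\<bar> > (1 + x) * \<sigma> / sqrt (real n)}
      \<subseteq> E1 \<union> E2 l \<union> E2 (- l)"
  proof (rule subsetI, rule ccontr)
    fix \<omega>
    assume "\<omega> \<in> {\<omega> \<in> space M. \<bar>trimmed_mean n k (\<lambda>i. X i \<omega>) - \<mu>\<bar> > (1 + x) * \<sigma> / sqrt (real n)}"
      and "\<omega> \<notin> E1 \<union> E2 l \<union> E2 (- l)"
    then have big: "\<bar>trimmed_mean n k (\<lambda>i. X i \<omega>) - \<mu>\<bar> > (1 + x) * \<sigma> / sqrt (real n)"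
      and good: "(\<Sum>i<n. 2 * N (X i \<omega>)) < 2 * real k"
        "(\<Sum>i<n. l * C (X i \<omega>)) < l * (s * (x + 3 * D))"
        "(\<Sum>i<n. - l * C (X i \<omega>)) < l * (s * (x + 3 * D))"
      by (auto simp: E1_def E2_def not_le)
    let ?S = "\<Sum>i<n. C (X i \<omega>)" and ?T = "trimmed_mean n k (\<lambda>i. X i \<omega>) - \<mu>"
    have cnt: "(\<Sum>i<n. N (X i \<omega>)) < real k + 1"
      using good(1) by (simp add: sum_distrib_left[symmetric])
    have "l * ?S < l * (s * (x + 3 * D))" "l * (- ?S) < l * (s * (x + 3 * D))"
      using good(2,3) by (simp_all add: sum_distrib_left sum_negf)
    then have S: "\<bar>?S\<bar> < s * (x + 3 * D)"
      using l(1) by (simp only: mult_less_cancel_left_pos abs_less_iff)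
    \<comment> \<open>Since kB = Ds, trimming adds 2Ds to the bound s(x + 3D) on the clamped sum,
      which gives x + 5D.\<close>
    have "\<bar>real (n - 2 * k) * ?T - ?S\<bar> \<le> 2 * real k * B"
      using cnt B k(2) unfolding N_def C_def by (intro trimmed_sum_near_clamped_sum) auto
    then have "\<bar>real (n - 2 * k) * ?T\<bar> < s * (x + 5 * D)"
      using S BD by (simp add: s_def[symmetric] algebra_simps)
    moreover have "real (n - 2 * k) * \<bar>?T\<bar> > real (n - 2 * k) * ((1 + x) * \<sigma> / sqrt (real n))"
      using big k by (intro mult_strict_left_mono) auto
    \<comment> \<open>This is \<open>xk\<close> scaled by \<sigma> / sqrt n.\<close>
    moreover have "real (n - 2 * k) * ((1 + x) * \<sigma> / sqrt (real n)) \<ge> s * (x + 5 * D)"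
    proof -
      have "s * (x + 5 * D) = (\<sigma> / sqrt (real n)) * ((x + 5 * D) * real n)"
        using n by (simp add: s_def real_div_sqrt field_simps)
      also have "\<dots> \<le> (\<sigma> / sqrt (real n)) * ((1 + x) * (real n - 2 * real k))"
        using xk \<sigma> n by (intro mult_left_mono) auto
      finally show ?thesis using k by (simp add: of_nat_diff mult_ac)
    qed
    ultimately show False unfolding abs_mult abs_of_nat by linarith
  qed
  have "prob {\<omega> \<in> space M. \<bar>trimmed_mean n k (\<lambda>i. X i \<omega>) - \<mu>\<bar> > (1 + x) * \<sigma> / sqrt (real n)}
      \<le> prob (E1 \<union> E2 l \<union> E2 (- l))"
    using sub ev by (intro finite_measure_mono) auto
  also have "\<dots> \<le> prob E1 + prob (E2 l) + prob (E2 (- l))"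
    using measure_Un_le[of "E1 \<union> E2 l" M "E2 (- l)"] measure_Un_le[of E1 M "E2 l"] ev by simp
  also have "\<dots> \<le> 3 * exp (- (x\<^sup>2) / 2)"
    using P1 P2[of l] P2[of "- l"] l(1) unfolding E1_def E2_def by simp
  finally show ?thesis .
qed

section \<open>The degenerate case of zero variance\<close>

lemma trimmed_mean_AE_const:
  fixes X :: "nat \<Rightarrow> 'a \<Rightarrow> real"
  assumes meas: "\<And>i. i < n \<Longrightarrow> X i \<in> borel_measurable M"
    and ident: "\<And>i. i < n \<Longrightarrow> distr M borel (X i) = distr M borel (X 0)"
    and k: "2 * k < n" and const: "AE \<omega> in M. X 0 \<omega> = \<mu>"
  shows "AE \<omega> in M. trimmed_mean n k (\<lambda>i. X i \<omega>) = \<mu>"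
proof -
  have "AE \<omega> in M. X i \<omega> = \<mu>" if "i < n" for i
  proof -
    have "AE y in distr M borel (X 0). y = \<mu>"
      using const meas[of 0] that by (subst AE_distr_iff) auto
    then have "AE y in distr M borel (X i). y = \<mu>" by (simp only: ident[OF that])
    then show ?thesis using meas[OF that] by (subst (asm) AE_distr_iff) auto
  qed
  then have "AE \<omega> in M. \<forall>i\<in>{..<n}. X i \<omega> = \<mu>" by (intro AE_finite_allI) auto
  then show ?thesis
  proof eventually_elim
    case (elim \<omega>)
    \<comment> \<open>Clamping at level B = 0: the clamped sum and the error bound both vanish,
      which forces the trimmed mean to be \<mu>.\<close>
    have "\<bar>real (n - 2 * k) * (trimmed_mean n k (\<lambda>i. X i \<omega>) - \<mu>)
           - (\<Sum>i<n. max (- 0) (min 0 (X i \<omega> - \<mu>)))\<bar> \<le> 2 * real k * 0"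
      using elim k by (intro trimmed_sum_near_clamped_sum) auto
    then show ?case using k by simp
  qed
qed

end

section \<open>From the assumption on k to the normalised parameters\<close>

text \<open>Bounds kB/\<sigma>, for the chosen level B, by the second term of the assumption on k.
  With b = (p-2)/(4p-4) and r = n/k \<ge> 1, the inequality 4p-4 \<ge> 2p gives b \<le> 1/2 - 1/p,
  hence r^(1/p) \<le> r^(1/2-b). The constant 3 bounds e^(2/p) \<le> e, and k sqrt r = sqrt(kn)
  produces the exponent 1/2 + b = (3p-4)/(4p-4) of k.\<close>

lemma truncation_level_bound:
  fixes n k :: nat
  assumes k: "1 \<le> k" "k \<le> n" and p: "p > 2" and \<kappa>: "\<kappa> \<ge> 0"
  shows "real k * (\<kappa> * (exp 2 * real n / real k) powr (1 / p))
     \<le> 3 * \<kappa> * (real k powr ((3*p - 4) / (4*p - 4)) / real n powr ((p - 2) / (4*p - 4))) * sqrt (real n)"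
proof -
  define b where "b = (p - 2) / (4*p - 4)"
  define r where "r = real n / real k"
  have r: "r \<ge> 1" and pos: "real k > 0" "real n > 0" using k by (auto simp: r_def)
  have "exp 2 powr (1 / p) \<le> exp (1::real)"
    using p by (simp add: exp_powr_real)
  then have e: "exp 2 powr (1 / p) \<le> (3::real)" using exp_le by linarith
  have "1 / p \<le> 1 / 2 - b"
  proof -
    have "b \<le> (p - 2) / (2 * p)"
      unfolding b_def using p by (intro divide_left_mono) auto
    then show ?thesis using p by (simp add: field_simps)
  qed
  then have "r powr (1 / p) \<le> r powr (1 / 2 - b)" using r by (intro powr_mono) auto
  also have "\<dots> = sqrt r / r powr b" using r by (simp add: powr_diff powr_half_sqrt)
  finally have rp: "r powr (1 / p) \<le> sqrt r / r powr b" .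
  have "(exp 2 * real n / real k) powr (1 / p) = exp 2 powr (1 / p) * r powr (1 / p)"
    using r by (simp add: r_def powr_mult[symmetric])
  also have "\<dots> \<le> 3 * (sqrt r / r powr b)"
    using e rp by (intro mult_mono) auto
  finally have "real k * (\<kappa> * (exp 2 * real n / real k) powr (1 / p)) \<le> real k * (\<kappa> * (3 * (sqrt r / r powr b)))"
    using \<kappa> by (intro mult_left_mono) auto
  also have "\<dots> = 3 * \<kappa> * (real k * sqrt r / r powr b)" by simp
  also have "real k * sqrt r / r powr b = (real k powr (1/2 + b) / real n powr b) * sqrt (real n)"
  proof -
    have "real k * sqrt r = sqrt (real k) * sqrt (real n)"
    proof -
      have "real k * sqrt r = sqrt (real k) * (sqrt (real k) * sqrt r)"
        by (simp add: mult.assoc[symmetric])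
      also have "sqrt (real k) * sqrt r = sqrt (real n)"
        using pos by (simp add: real_sqrt_mult[symmetric] r_def)
      finally show ?thesis .
    qed
    then show ?thesis using pos
      by (simp add: r_def powr_divide powr_add powr_half_sqrt)
  qed
  also have "1/2 + b = (3*p - 4) / (4*p - 4)" using p by (simp add: b_def field_simps)
  finally show ?thesis by (simp add: b_def)
qed

section \<open>Choice of the truncation level and conclusion\<close>

theorem theorem1p3:
  fixes M :: "'a measure" and X :: "nat \<Rightarrow> 'a \<Rightarrow> real"
    and n k :: nat and \<mu> \<sigma> p \<kappa> x :: real
  assumes "prob_space M"
    and "n \<ge> 1"
    and meas: "\<And>i. i < n \<Longrightarrow> X i \<in> borel_measurable M"
    and indep: "prob_space.indep_vars M (\<lambda>_. borel) X {..<n}"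
    and ident: "\<And>i. i < n \<Longrightarrow> distr M borel (X i) = distr M borel (X 0)"
    and int1: "integrable M (X 0)"
    and mu: "\<mu> = prob_space.expectation M (X 0)"
    and int2: "integrable M (\<lambda>\<omega>. (X 0 \<omega>)\<^sup>2)"
    and sigma: "\<sigma> = sqrt (prob_space.variance M (X 0))"
    and "p > 2" and "\<kappa> \<ge> 1"
    and moment: "(\<integral>\<^sup>+\<omega>. ennreal (\<bar>X 0 \<omega> - \<mu>\<bar> powr p) \<partial>M) \<le> ennreal ((\<kappa> * \<sigma>) powr p)"
    and kcond: "432 * real k powr (3/2) / real n
        + 24 * sqrt 2 * \<kappa> * real k powr ((3*p - 4) / (4*p - 4)) / real n powr ((p - 2) / (4*p - 4)) \<le> 1"
    and "0 < x" and "x \<le> sqrt (2 * real k)"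
  shows "measure M {\<omega> \<in> space M. \<bar>trimmed_mean n k (\<lambda>i. X i \<omega>) - \<mu>\<bar> > (1 + x) * \<sigma> / sqrt (real n)}
           \<le> 4 * exp (- (x\<^sup>2) / 2)"
proof -
  interpret prob_space M by fact
  \<comment> \<open>For k = 0 the range 0 < x \<le> sqrt(2k) is empty.\<close>
  have k: "1 \<le> k" using \<open>0 < x\<close> \<open>x \<le> sqrt (2 * real k)\<close> by (cases k) auto
  have n0: "real n > 0" using \<open>n \<ge> 1\<close> by simp
  have X0: "X 0 \<in> borel_measurable M" using int1 by auto
  let ?R = "real k powr ((3*p - 4) / (4*p - 4)) / real n powr ((p - 2) / (4*p - 4))"
  have R0: "?R \<ge> 0" by simp
  \<comment> \<open>Both summands of the assumption are nonnegative, so each is at most 1. The first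
    controls the loss n/(n-2k), the second controls D.\<close>
  have c1: "432 * (real k powr (3/2) / real n) \<le> 1" and c2: "24 * sqrt 2 * \<kappa> * ?R \<le> 1"
  proof -
    have "0 \<le> 432 * (real k powr (3/2) / real n)" "0 \<le> 24 * sqrt 2 * \<kappa> * ?R" using \<open>\<kappa> \<ge> 1\<close> by simp_all
    then show "432 * (real k powr (3/2) / real n) \<le> 1" "24 * sqrt 2 * \<kappa> * ?R \<le> 1"
      using kcond unfolding times_divide_eq_right by linarith+
  qed
  have sk: "1 \<le> sqrt (real k)" using k by simp
  have "real k powr (3/2) = real k * sqrt (real k)"
    using powr_add[of "real k" 1 "1/2"] k by (simp add: powr_half_sqrt)
  then have kn: "432 * (real k * sqrt (real k)) \<le> real n"
    using c1 n0 by (simp add: field_simps)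
  moreover have "real k \<le> real k * sqrt (real k)" using sk by (simp add: mult_le_cancel_left1)
  ultimately have kn': "432 * real k \<le> real n" by linarith
  then have k2: "2 * k < n" using k by linarith
  have intv: "integrable M (\<lambda>\<omega>. (X 0 \<omega> - \<mu>)\<^sup>2)"
    using int1 int2 by (simp add: power2_diff)
  have var: "expectation (\<lambda>\<omega>. (X 0 \<omega> - \<mu>)\<^sup>2) = \<sigma>\<^sup>2" using mu sigma by simp
  have "\<sigma> \<ge> 0" by (simp add: sigma)
  show ?thesis
  \<comment> \<open>The normalisation divides by \<sigma>. If \<sigma> = 0, the event says that the
    trimmed mean differs from \<mu>, which has probability zero.\<close>
  proof (cases "\<sigma> = 0")
    case True
    then have "AE \<omega> in M. X 0 \<omega> = \<mu>"
      using integral_nonneg_eq_0_iff_AE[OF intv] var by simp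
    then have "AE \<omega> in M. trimmed_mean n k (\<lambda>i. X i \<omega>) = \<mu>"
      by (intro trimmed_mean_AE_const meas ident k2)
    then obtain N where N: "N \<in> null_sets M" "{\<omega> \<in> space M. trimmed_mean n k (\<lambda>i. X i \<omega>) \<noteq> \<mu>} \<subseteq> N"
      by (auto elim!: AE_E simp: null_sets_def)
    have "measure M {\<omega> \<in> space M. \<bar>trimmed_mean n k (\<lambda>i. X i \<omega>) - \<mu>\<bar> > (1 + x) * \<sigma> / sqrt (real n)} \<le> measure M N"
      using N True by (intro finite_measure_mono) auto
    also have "measure M N = 0" using N(1) by (rule measure_eq_0_null_sets)
    finally show ?thesis by (rule order_trans) simp
  next
    case False
    with \<open>\<sigma> \<ge> 0\<close> have \<sigma>: "\<sigma> > 0" by simp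
    have intp: "integrable M (\<lambda>\<omega>. \<bar>X 0 \<omega> - \<mu>\<bar> powr p)"
      using moment X0 by (intro integrableI_bounded) (auto simp: order_le_less_trans)
    have mom: "expectation (\<lambda>\<omega>. \<bar>X 0 \<omega> - \<mu>\<bar> powr p) \<le> (\<kappa> * \<sigma>) powr p"
      using moment intp by (simp add: nn_integral_eq_integral)
    \<comment> \<open>h makes the Chernoff exponent of the outside count equal to -k, and B solves h
      B^p = (\<kappa>\<sigma>)^p, so that Markov's inequality at level B gives probability at most
      h.\<close>
    define h where "h = real k / (exp 2 * real n)"
    define B where "B = \<kappa> * \<sigma> * (1 / h) powr (1 / p)"
    define D where "D = real k * B / (\<sigma> * sqrt (real n))"
    have h: "h > 0" using k n0 by (simp add: h_def)
    have B: "B > 0" using \<sigma> \<open>\<kappa> \<ge> 1\<close> h by (simp add: B_def)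
    have hB: "h * B powr p = (\<kappa> * \<sigma>) powr p"
      using h \<sigma> \<open>\<kappa> \<ge> 1\<close> \<open>p > 2\<close> by (simp add: B_def powr_mult powr_powr powr_divide)
    have "real k * (B / \<sigma>) \<le> 3 * (\<kappa> * ?R) * sqrt (real n)"
      using truncation_level_bound[of k n p \<kappa>] k k2 \<open>p > 2\<close> \<open>\<kappa> \<ge> 1\<close> \<sigma>
      by (simp add: B_def h_def mult_ac)
    then have "D \<le> 3 * (\<kappa> * ?R)"
      using \<sigma> n0 by (simp add: D_def field_simps)
    \<comment> \<open>With R the quotient of powers \<open>?R\<close>, this gives 10 D \<le> 30
      \<kappa> R \<le> 24 sqrt 2 \<kappa> R \<le> 1.\<close>
    moreover have "30 * (\<kappa> * ?R) \<le> 24 * sqrt 2 * (\<kappa> * ?R)"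
    proof (rule mult_right_mono)
      have "(5 / 4 :: real) \<le> sqrt 2" by (rule real_le_rsqrt) (simp add: power2_eq_square)
      then show "30 \<le> 24 * sqrt (2::real)" by simp
    qed (use \<open>\<kappa> \<ge> 1\<close> in simp)
    ultimately have D: "D \<le> 1 / 10" using c2 by (simp add: mult.assoc)
    \<comment> \<open>After cancelling xn, the claim is 5Dn + 2k(1+x) \<le> n. Each summand is at
      most n/2: the first by D \<le> 1/10, the second by x \<le> 2 sqrt k and 432 k^(3/2) \<le>
      n.\<close>
    have xk: "(x + 5 * D) * real n \<le> (1 + x) * (real n - 2 * real k)"
    proof -
      have "x \<le> 2 * sqrt (real k)"
        using \<open>x \<le> sqrt (2 * real k)\<close> sqrt2_less_2 mult_right_mono[of "sqrt 2" 2 "sqrt (real k)"]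
        by (simp add: real_sqrt_mult)
      then have "(1 + x) * (2 * real k) \<le> (1 + 2 * sqrt (real k)) * (2 * real k)"
        by (intro mult_right_mono) auto
      also have "\<dots> = 2 * real k + 4 * (real k * sqrt (real k))" by (simp add: algebra_simps)
      also have "\<dots> \<le> real n / 2" using kn kn' by linarith
      finally have "(1 + x) * (2 * real k) \<le> real n / 2" .
      moreover have "D * real n \<le> 1 / 10 * real n" using D n0 by (intro mult_right_mono) auto
      ultimately show ?thesis by (simp add: algebra_simps)
    qed
    have "measure M {\<omega> \<in> space M. \<bar>trimmed_mean n k (\<lambda>i. X i \<omega>) - \<mu>\<bar> > (1 + x) * \<sigma> / sqrt (real n)}
        \<le> 3 * exp (- (x\<^sup>2) / 2)"
    proof (rule trimmed_mean_deviation[OF indep ident k k2 int1 mu[symmetric] intv eq_refl[OF var]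
          \<sigma> intp _ _ B _ _ D \<open>0 < x\<close> \<open>x \<le> sqrt (2 * real k)\<close> xk])
      show "p \<ge> 1" using \<open>p > 2\<close> by simp
      show "expectation (\<lambda>\<omega>. \<bar>X 0 \<omega> - \<mu>\<bar> powr p) \<le> h * B powr p" using mom hB by simp
      show "real n * h * exp 2 = real k" using n0 by (simp add: h_def)
      show "real k * B = D * (\<sigma> * sqrt (real n))" using \<sigma> n0 by (simp add: D_def)
    qed
    also have "\<dots> \<le> 4 * exp (- (x\<^sup>2) / 2)" by simp
    finally show ?thesis .
  qed
qed

end
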